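(* The sequence $$0\longrightarrow 2\mathcal C(\mathbb Z)\longrightarrow \mathcal C(\mathbb Z)\xrightarrow{\ \alpha\ }\mathbb Q^\times/\mathbb Q^{\times2}$$ is exact; that is, the kernel of the homomorphism $\alpha$ restricted to $\mathcal C(\mathbb Z)$ equals $2\mathcal C(\mathbb Z)=\{P+P: P\in\mathcal C(\mathbb Z)\}$.
   Context: Let $d$ be a squarefree integer with $d\neq 1$, and put $\Delta=d$ if $d\equiv 1\pmod 4$ and $\Delta=4d$ if $d\equiv 2,3\pmod 4$. Let $\mathcal C(\mathbb Z)=\{(x,y)\in\mathbb Z^2: x^2-\Delta y^2=4\}$, an abelian group with neutral element $(2,0)$ and addition $(r,s)+(t,u)=\big(\frac{rt+\Delta su}{2},\frac{ru+st}{2}\big)$; in particular $2(r,s)=(r^2-2,rs)$. The map $\alpha:\mathcal C(\mathbb Z)\to\mathbb Q^\times/\mathbb Q^{\times2}$ is $\alpha(x,y)=(x+2)\mathbb Q^{\times2}$ if $x\neq -2$ and $\alpha(-2,0)=-\Delta\,\mathbb Q^{\times2}$; it is a group homomorphism. *)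

theory Defs
  imports
    "HOL-Algebra.Algebra"
    "HOL-Computational_Algebra.Squarefree"
begin

definition quad_disc :: "int \<Rightarrow> int"
  where "quad_disc d = (if d mod 4 = 1 then d else 4 * d)"

(* The integer divisions by 2 are exact on integral points, see pell_conic_even below. *)
definition pell_conic :: "int \<Rightarrow> (int \<times> int) monoid"
  where "pell_conic D =
    \<lparr>carrier = {(x, y). x\<^sup>2 - D * y\<^sup>2 = 4},
     monoid.mult = (\<lambda>(r, s) (t, u). ((r * t + D * s * u) div 2, (r * u + s * t) div 2)),
     one = (2, 0)\<rparr>"

definition doubles :: "('a, 'b) monoid_scheme \<Rightarrow> 'a set"
  where "doubles G = {P \<otimes>\<^bsub>G\<^esub> P | P. P \<in> carrier G}"

definition rat_units :: "rat monoid"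
  where "rat_units = \<lparr>carrier = {q. q \<noteq> 0}, monoid.mult = (*), one = 1\<rparr>"

definition rat_unit_squares :: "rat set"
  where "rat_unit_squares = {q\<^sup>2 | q. q \<noteq> 0}"

definition rat_square_classes :: "rat set monoid"
  where "rat_square_classes = rat_units Mod rat_unit_squares"

(* On the conic with D \<noteq> 0 the only point with x = -2 is (-2, 0). *)
definition pell_alpha :: "int \<Rightarrow> int \<times> int \<Rightarrow> rat set"
  where "pell_alpha D = (\<lambda>(x, y).
    rat_unit_squares #>\<^bsub>rat_units\<^esub> (if x \<noteq> -2 then of_int (x + 2) else of_int (- D)))"

(* Exactness of G -f-> H -g-> K at H. The library predicate exact_seq forces all groups of a
   sequence to have the same element type, which fails here. *)
definition exact_at ::
  "('a, 'm) monoid_scheme \<Rightarrow> ('a \<Rightarrow> 'b) \<Rightarrow> ('b, 'n) monoid_scheme \<Rightarrow> ('b \<Rightarrow> 'c)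
    \<Rightarrow> ('c, 'k) monoid_scheme \<Rightarrow> bool"
  where "exact_at G f H g K \<longleftrightarrow>
    group_hom G H f \<and> group_hom H K g \<and> kernel H K g = f ` carrier G"

lemma pell_conic_even:
  fixes D :: int
  assumes "(r, s) \<in> carrier (pell_conic D)" "(t, u) \<in> carrier (pell_conic D)"
  shows "even (r * t + D * s * u)" "even (r * u + s * t)"
proof -
  have *: "even x \<longleftrightarrow> even (D * y)" if "x\<^sup>2 - D * y\<^sup>2 = 4" for x y :: int
  proof -
    have "x\<^sup>2 = D * y\<^sup>2 + 4" using that by simp
    then have "even (x\<^sup>2) \<longleftrightarrow> even (D * y\<^sup>2 + 4)" by simp
    then show ?thesis by simp
  qed
  have "even r \<longleftrightarrow> even (D * s)" "even t \<longleftrightarrow> even (D * u)"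
    using assms *[of r s] *[of t u] by (simp_all add: pell_conic_def)
  then show "even (r * t + D * s * u)" "even (r * u + s * t)" by auto
qed

lemma pell_conic_mult_exact:
  assumes "(r, s) \<in> carrier (pell_conic D)" "(t, u) \<in> carrier (pell_conic D)"
  obtains v w where "(r, s) \<otimes>\<^bsub>pell_conic D\<^esub> (t, u) = (v, w)"
    "2 * v = r * t + D * s * u" "2 * w = r * u + s * t" "(v, w) \<in> carrier (pell_conic D)"
proof -
  define v where "v = (r * t + D * s * u) div 2"
  define w where "w = (r * u + s * t) div 2"
  have v: "2 * v = r * t + D * s * u" and w: "2 * w = r * u + s * t"
    using pell_conic_even[OF assms] by (auto simp: v_def w_def)
  have "4 * (v\<^sup>2 - D * w\<^sup>2) = (2 * v)\<^sup>2 - D * (2 * w)\<^sup>2" by (simp add: power2_eq_square)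
  also have "\<dots> = (r\<^sup>2 - D * s\<^sup>2) * (t\<^sup>2 - D * u\<^sup>2)"
    unfolding v w by (simp add: power2_eq_square algebra_simps)
  also have "\<dots> = 16" using assms by (simp add: pell_conic_def)
  finally have "v\<^sup>2 - D * w\<^sup>2 = 4" by simp
  then have "(v, w) \<in> carrier (pell_conic D)" by (simp add: pell_conic_def)
  moreover have "(r, s) \<otimes>\<^bsub>pell_conic D\<^esub> (t, u) = (v, w)"
    by (simp add: pell_conic_def v_def w_def)
  ultimately show ?thesis using that v w by blast
qed

lemma pell_conic_comm_group: "comm_group (pell_conic D)"
proof (rule comm_groupI)
  fix x y assume x: "x \<in> carrier (pell_conic D)" and y: "y \<in> carrier (pell_conic D)"
  show "x \<otimes>\<^bsub>pell_conic D\<^esub> y \<in> carrier (pell_conic D)"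
    using x y by (metis pell_conic_mult_exact surj_pair)
  show "x \<otimes>\<^bsub>pell_conic D\<^esub> y = y \<otimes>\<^bsub>pell_conic D\<^esub> x"
    by (simp add: pell_conic_def case_prod_beta ac_simps)
next
  fix x y z
  assume x: "x \<in> carrier (pell_conic D)" and y: "y \<in> carrier (pell_conic D)"
    and z: "z \<in> carrier (pell_conic D)"
  obtain x1 x2 y1 y2 z1 z2 where eqs: "x = (x1, x2)" "y = (y1, y2)" "z = (z1, z2)"
    by (cases x, cases y, cases z)
  obtain a b where ab: "x \<otimes>\<^bsub>pell_conic D\<^esub> y = (a, b)"
    "2 * a = x1 * y1 + D * x2 * y2" "2 * b = x1 * y2 + x2 * y1" "(a, b) \<in> carrier (pell_conic D)"
    using pell_conic_mult_exact x y unfolding eqs by metis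
  obtain c e where ce: "y \<otimes>\<^bsub>pell_conic D\<^esub> z = (c, e)"
    "2 * c = y1 * z1 + D * y2 * z2" "2 * e = y1 * z2 + y2 * z1" "(c, e) \<in> carrier (pell_conic D)"
    using pell_conic_mult_exact y z unfolding eqs by metis
  obtain f g where fg: "(a, b) \<otimes>\<^bsub>pell_conic D\<^esub> z = (f, g)"
    "2 * f = a * z1 + D * b * z2" "2 * g = a * z2 + b * z1"
    using pell_conic_mult_exact ab(4) z unfolding eqs by metis
  obtain h k where hk: "x \<otimes>\<^bsub>pell_conic D\<^esub> (c, e) = (h, k)"
    "2 * h = x1 * c + D * x2 * e" "2 * k = x1 * e + x2 * c"
    using pell_conic_mult_exact ce(4) x unfolding eqs by metis
  have "2 * (2 * f) = (2 * a) * z1 + D * (2 * b) * z2" unfolding fg by (simp add: algebra_simps)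
  also have "\<dots> = x1 * (2 * c) + D * x2 * (2 * e)" unfolding ab ce by (simp add: algebra_simps)
  also have "\<dots> = 2 * (2 * h)" unfolding hk by (simp add: algebra_simps)
  finally have "f = h" by simp
  have "2 * (2 * g) = (2 * a) * z2 + (2 * b) * z1" unfolding fg by (simp add: algebra_simps)
  also have "\<dots> = x1 * (2 * e) + x2 * (2 * c)" unfolding ab ce by (simp add: algebra_simps)
  also have "\<dots> = 2 * (2 * k)" unfolding hk by (simp add: algebra_simps)
  finally have "g = k" by simp
  show "x \<otimes>\<^bsub>pell_conic D\<^esub> y \<otimes>\<^bsub>pell_conic D\<^esub> z =
      x \<otimes>\<^bsub>pell_conic D\<^esub> (y \<otimes>\<^bsub>pell_conic D\<^esub> z)"
    using ab(1) ce(1) fg(1) hk(1) \<open>f = h\<close> \<open>g = k\<close> by simp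
next
  fix x assume x: "x \<in> carrier (pell_conic D)"
  obtain r s where rs: "x = (r, s)" by (cases x)
  have n: "(r, -s) \<in> carrier (pell_conic D)" using x rs by (simp add: pell_conic_def)
  have "r * r - D * s * s = 4"
    using x rs by (simp add: pell_conic_def power2_eq_square algebra_simps)
  then have "(r, -s) \<otimes>\<^bsub>pell_conic D\<^esub> x = \<one>\<^bsub>pell_conic D\<^esub>"
    by (simp add: rs pell_conic_def algebra_simps)
  then show "\<exists>y\<in>carrier (pell_conic D). y \<otimes>\<^bsub>pell_conic D\<^esub> x = \<one>\<^bsub>pell_conic D\<^esub>"
    using n by blast
qed (auto simp: pell_conic_def)

lemma rat_units_comm_group: "comm_group rat_units"
proof (rule comm_groupI)
  fix x assume "x \<in> carrier rat_units"
  then show "\<exists>y\<in>carrier rat_units. y \<otimes>\<^bsub>rat_units\<^esub> x = \<one>\<^bsub>rat_units\<^esub>"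
    by (intro bexI[of _ "inverse x"]) (auto simp: rat_units_def)
qed (auto simp: rat_units_def)

lemma rat_unit_squares_normal: "rat_unit_squares \<lhd> rat_units"
proof -
  interpret comm_group rat_units by (rule rat_units_comm_group)
  have inv: "inv\<^bsub>rat_units\<^esub> q = inverse q" if "q \<noteq> 0" for q
    using that by (intro inv_equality) (auto simp: rat_units_def)
  have "subgroup rat_unit_squares rat_units"
  proof (rule subgroupI)
    show "rat_unit_squares \<subseteq> carrier rat_units" "rat_unit_squares \<noteq> {}"
      by (auto simp: rat_unit_squares_def rat_units_def intro: exI[of _ 1])
    show "inv\<^bsub>rat_units\<^esub> a \<in> rat_unit_squares" if "a \<in> rat_unit_squares" for a
    proof -
      obtain q where "a = q\<^sup>2" "q \<noteq> 0" using \<open>a \<in> rat_unit_squares\<close>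
        by (auto simp: rat_unit_squares_def)
      then have "inv\<^bsub>rat_units\<^esub> a = (inverse q)\<^sup>2" "inverse q \<noteq> 0"
        using inv[of "q\<^sup>2"] by (simp_all add: power_inverse)
      then show ?thesis unfolding rat_unit_squares_def by blast
    qed
    show "a \<otimes>\<^bsub>rat_units\<^esub> b \<in> rat_unit_squares"
      if "a \<in> rat_unit_squares" "b \<in> rat_unit_squares" for a b
      using that
      by (auto simp: rat_unit_squares_def rat_units_def simp flip: power_mult_distrib)
  qed
  then show ?thesis by (rule subgroup_imp_normal)
qed

end

theory Submission
  imports Defs
begin

text \<open>
  Put \<open>\<beta>(x) = x + 2\<close> for \<open>x \<noteq> -2\<close> and \<open>\<beta>(-2) = -D\<close>. If \<open>(v, w) = (r, s) + (t, u)\<close>, then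
  \<open>r\<^sup>2 + t\<^sup>2 + v\<^sup>2 - r t v = 4\<close>, equivalently \<open>(r + 2)(t + 2)(v + 2) = (r + t + v + 2)\<^sup>2\<close>; hence
  \<open>\<beta>(r) \<beta>(t) \<beta>(v)\<close> is a square and \<open>\<alpha>\<close> is a homomorphism, which kills doubles.
  Conversely, if \<open>x + 2 = m\<^sup>2\<close> with \<open>m \<noteq> 0\<close>, then \<open>m\<^sup>2 (m\<^sup>2 - 4) = D y\<^sup>2\<close>, and since \<open>D\<close> is a
  fundamental discriminant this forces \<open>y = m n\<close>, so that \<open>(x, y) = 2 (m, n)\<close>.
  The point \<open>(-2, 0)\<close> lies in the kernel only for \<open>D = -4\<close>, where it is \<open>2 (0, 1)\<close>.
\<close>

section \<open>Squares, squarefree integers and fundamental discriminants\<close>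

lemma int_square_if_rat_square:
  fixes n :: int and q :: rat
  assumes "of_int n = q\<^sup>2"
  obtains m :: int where "n = m\<^sup>2"
proof -
  obtain a b where ab: "quotient_of q = (a, b)" by (cases "quotient_of q")
  have b: "b > 0" and q: "q = of_int a / of_int b"
    using quotient_of_denom_pos[OF ab] quotient_of_div[OF ab] by auto
  have "(of_int (n * b\<^sup>2) :: rat) = of_int (a\<^sup>2)"
    using assms b by (simp add: q power_divide field_simps)
  then have eq: "n * b\<^sup>2 = a\<^sup>2" by (simp only: of_int_eq_iff)
  then have "b\<^sup>2 dvd a\<^sup>2" by (metis dvd_triv_right)
  then have "b dvd a" by simp
  then obtain k where "a = b * k" by blast
  with eq b have "n = k\<^sup>2" by (simp add: power_mult_distrib)
  then show ?thesis by (rule that)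
qed

text \<open>Dividing \<open>m\<close> and \<open>y\<close> by their gcd leaves a cofactor of
  \<open>m\<close> coprime to that of \<open>y\<close>. The square of this cofactor divides
  \<open>e\<close>, so the cofactor is a unit.\<close>

lemma dvd_if_square_dvd_squarefree_mult_square:
  fixes e m y :: int
  assumes "squarefree e" "m \<noteq> 0" "m\<^sup>2 dvd e * y\<^sup>2"
  shows "m dvd y"
proof -
  define g where "g = gcd m y"
  have "g \<noteq> 0" using assms(2) by (simp add: g_def)
  then obtain m' y' where m: "m = m' * g" and y: "y = y' * g" and "coprime m' y'"
    using gcd_coprime_exists[of m y] unfolding g_def by blast
  have "m'\<^sup>2 * g\<^sup>2 dvd (e * y'\<^sup>2) * g\<^sup>2"
    using assms(3) unfolding m y by (simp only: power_mult_distrib mult.assoc)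
  then have "m'\<^sup>2 dvd e * y'\<^sup>2" using \<open>g \<noteq> 0\<close> by simp
  then have "m'\<^sup>2 dvd e"
    using \<open>coprime m' y'\<close> by (simp add: coprime_dvd_mult_left_iff)
  then have "m' dvd 1" using assms(1) unfolding squarefree_def by blast
  then have "m' dvd y'" by (rule dvd_trans) simp
  then show ?thesis unfolding m y by (rule mult_dvd_mono) simp
qed

lemma square_mod_4: "(k::int)\<^sup>2 mod 4 = (if even k then 0 else 1)"
proof (cases "even k")
  case True
  then show ?thesis by (auto elim!: evenE simp: power2_eq_square)
next
  case False
  then obtain j where "k = 2 * j + 1" by (auto elim: oddE)
  then have "k\<^sup>2 = 4 * (j\<^sup>2 + j) + 1" by (simp add: power2_eq_square algebra_simps)
  then show ?thesis using False by simp presburger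
qed

text \<open>The squarefree argument suffices for discriminant \<open>d\<close>. For discriminant
  \<open>4 * d\<close> it only yields \<open>m dvd 2 * y\<close>, and a congruence modulo 4 removes
  the factor 2.\<close>

lemma quad_disc_dvd:
  fixes d m y :: int
  assumes "squarefree d" "m \<noteq> 0" and eq: "m\<^sup>2 * (m\<^sup>2 - 4) = quad_disc d * y\<^sup>2"
  shows "m dvd y"
proof (cases "d mod 4 = 1")
  case True
  then have "m\<^sup>2 dvd d * y\<^sup>2" using eq by (metis dvd_triv_left quad_disc_def)
  with assms show ?thesis by (blast intro: dvd_if_square_dvd_squarefree_mult_square)
next
  case False
  have eq': "m\<^sup>2 * (m\<^sup>2 - 4) = d * (2 * y)\<^sup>2"
    using eq False by (simp add: quad_disc_def power_mult_distrib)
  then have "m\<^sup>2 dvd d * (2 * y)\<^sup>2" by (metis dvd_triv_left)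
  then have "m dvd 2 * y"
    using assms by (blast intro: dvd_if_square_dvd_squarefree_mult_square)
  then obtain k where k: "2 * y = m * k" by blast
  have "m\<^sup>2 * (m\<^sup>2 - 4) = m\<^sup>2 * (d * k\<^sup>2)"
    using eq' unfolding k by (simp add: power_mult_distrib mult_ac)
  then have dk: "m\<^sup>2 - 4 = d * k\<^sup>2" using \<open>m \<noteq> 0\<close> by simp
  \<comment> \<open>For odd \<open>k\<close>, \<open>d\<close> is congruent to d k^2 = m^2 - 4,
    hence to 0 or 1 modulo 4. The first contradicts squarefreeness, the second the case
    assumption.\<close>
  have "even k"
  proof (rule ccontr)
    assume "odd k"
    have "\<not> 4 dvd d"
      using \<open>squarefree d\<close> squarefreeD[of d 2] by auto
    moreover have "d mod 4 = (d * k\<^sup>2) mod 4"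
      using square_mod_4[of k] \<open>odd k\<close> by (metis mod_mult_right_eq mult.right_neutral)
    moreover have "(d * k\<^sup>2) mod 4 = m\<^sup>2 mod 4" by (simp flip: dk)
    ultimately show False using False square_mod_4[of m] by (auto split: if_splits)
  qed
  then obtain n where "k = 2 * n" by blast
  with k show ?thesis by simp
qed

text \<open>In both cases \<open>- d\<close> is a square, so squarefreeness forces
  \<open>d = -1\<close>. As -1 is 3 modulo 4, the discriminant is then \<open>4 * d\<close>.\<close>

lemma minus_quad_disc_square:
  fixes d m :: int
  assumes "squarefree d" "- quad_disc d = m\<^sup>2"
  shows "quad_disc d = -4"
proof -
  have unit: "k = 1 \<or> k = -1" if "k\<^sup>2 = - d" for k
  proof -
    have "k\<^sup>2 dvd d" using that by simp
    with assms(1) have "k dvd 1" unfolding squarefree_def by blast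
    then show ?thesis by auto
  qed
  show ?thesis
  proof (cases "d mod 4 = 1")
    case True
    with assms(2) have "m\<^sup>2 = - d" by (simp add: quad_disc_def)
    with unit[of m] True show ?thesis by auto
  next
    case False
    with assms(2) have m: "m\<^sup>2 = - (4 * d)" by (simp add: quad_disc_def)
    then have "even (m\<^sup>2)" by simp
    then have "even m" by simp
    then obtain k where "m = 2 * k" by blast
    with m have "k\<^sup>2 = - d" by simp
    with unit[of k] False show ?thesis by (auto simp: quad_disc_def)
  qed
qed

section \<open>The map \<alpha> through integer representatives\<close>

definition alpha_rep :: "int \<Rightarrow> int \<Rightarrow> int"
  where "alpha_rep D x = (if x \<noteq> -2 then x + 2 else - D)"

lemma alpha_rep_nonzero: "D \<noteq> 0 \<Longrightarrow> alpha_rep D x \<noteq> 0"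
  by (simp add: alpha_rep_def)

lemma pell_alpha_eq:
  "pell_alpha D (x, y) = rat_unit_squares #>\<^bsub>rat_units\<^esub> of_int (alpha_rep D x)"
  by (simp add: pell_alpha_def alpha_rep_def)

text \<open>Every square class is its own inverse, so this symmetric form expresses multiplicativity
  of \<alpha> without division.\<close>

lemma alpha_rep_mult_square:
  fixes D r s t u v :: int
  assumes rs: "r\<^sup>2 - D * s\<^sup>2 = 4" and tu: "t\<^sup>2 - D * u\<^sup>2 = 4"
    and v: "2 * v = r * t + D * s * u"
  shows "\<exists>z. alpha_rep D r * alpha_rep D t * alpha_rep D v = z\<^sup>2"
proof -
  \<comment> \<open>Squaring allows \<open>s\<close> and \<open>u\<close> to be eliminated by the
    two conic equations.\<close>
  have "(2 * v - r * t)\<^sup>2 = (D * s\<^sup>2) * (D * u\<^sup>2)"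
    by (simp add: v power2_eq_square)
  also have "\<dots> = (r\<^sup>2 - 4) * (t\<^sup>2 - 4)" using rs tu by (simp add: algebra_simps)
  finally have "4 * (r\<^sup>2 + t\<^sup>2 + v\<^sup>2 - r * t * v) = 16"
    by (simp add: power2_eq_square algebra_simps)
  then have prod: "(r + 2) * (t + 2) * (v + 2) = (r + t + v + 2)\<^sup>2"
    by (simp add: power2_eq_square algebra_simps)
  \<comment> \<open>Generically (2 + a)(2 - a) = -D b^2. At a = 2 or a = -2 the two representatives
    are 4 and -D, which gives the second square.\<close>
  have opposite: "- D * alpha_rep D a * alpha_rep D (- a) = (D * b)\<^sup>2 \<or>
      - D * alpha_rep D a * alpha_rep D (- a) = (2 * D)\<^sup>2"
    if "a\<^sup>2 - D * b\<^sup>2 = 4" for a b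
  proof (cases "a = 2 \<or> a = -2")
    case True
    then show ?thesis by (auto simp: alpha_rep_def power2_eq_square)
  next
    case False
    then have "- D * alpha_rep D a * alpha_rep D (- a) = D * (a\<^sup>2 - 4)"
      by (auto simp: alpha_rep_def power2_eq_square algebra_simps)
    also have "a\<^sup>2 - 4 = D * b\<^sup>2" using that by simp
    finally show ?thesis by (simp add: power2_eq_square)
  qed
  \<comment> \<open>If one coordinate is -2, the left side of \<open>prod\<close> vanishes, so the
    other two are opposite. The representative at -2 supplies the factor \<open>- D\<close> in
    \<open>opposite\<close>.\<close>
  consider "r = -2" | "t = -2" | "v = -2" | "r \<noteq> -2" "t \<noteq> -2" "v \<noteq> -2" by blast
  then show ?thesis
  proof cases
    case 1
    with prod have "v = - t" by simp
    with 1 opposite[OF tu] show ?thesis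
      by (metis alpha_rep_def)
  next
    case 2
    with prod have "v = - r" by simp
    with 2 opposite[OF rs] show ?thesis
      by (metis alpha_rep_def mult.commute)
  next
    case 3
    with prod have "t = - r" by simp
    with 3 opposite[OF rs] show ?thesis
      by (metis alpha_rep_def mult.commute mult.assoc)
  next
    case 4
    with prod show ?thesis by (auto simp: alpha_rep_def)
  qed
qed

text \<open>The quotient p/q and the product pq differ by the square q^2. The product form lets
  integer representatives be compared without inverses.\<close>

lemma rat_square_coset_eq_iff:
  assumes "p \<noteq> 0" "q \<noteq> 0"
  shows "rat_unit_squares #>\<^bsub>rat_units\<^esub> p = rat_unit_squares #>\<^bsub>rat_units\<^esub> q
    \<longleftrightarrow> p * q \<in> rat_unit_squares"
proof -
  interpret comm_group rat_units by (rule rat_units_comm_group)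
  interpret S: normal rat_unit_squares rat_units by (rule rat_unit_squares_normal)
  have inv: "inv\<^bsub>rat_units\<^esub> q = inverse q"
    using assms by (intro inv_equality) (auto simp: rat_units_def)
  have pq: "p \<in> carrier rat_units" "q \<in> carrier rat_units"
    using assms by (auto simp: rat_units_def)
  have sq: "q\<^sup>2 \<in> rat_unit_squares" "inverse (q\<^sup>2) \<in> rat_unit_squares"
    using assms by (auto simp: rat_unit_squares_def simp flip: power_inverse)
  have "rat_unit_squares #>\<^bsub>rat_units\<^esub> p = rat_unit_squares #>\<^bsub>rat_units\<^esub> q
    \<longleftrightarrow> p \<in> rat_unit_squares #>\<^bsub>rat_units\<^esub> q"
    using pq repr_independence[OF _ _ S.subgroup_axioms] rcos_self[OF _ S.subgroup_axioms]
    by metis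
  also have "\<dots> \<longleftrightarrow> p * inverse q \<in> rat_unit_squares"
    using S.rcos_module[OF group_axioms pq(2,1)] by (simp add: inv) (simp add: rat_units_def)
  also have "\<dots> \<longleftrightarrow> p * q \<in> rat_unit_squares"
  proof
    assume "p * inverse q \<in> rat_unit_squares"
    then have "(p * inverse q) * q\<^sup>2 \<in> rat_unit_squares"
      using S.m_closed[OF _ sq(1)] by (simp add: rat_units_def)
    moreover have "(p * inverse q) * q\<^sup>2 = p * q"
      using assms by (simp add: power2_eq_square field_simps)
    ultimately show "p * q \<in> rat_unit_squares" by simp
  next
    assume "p * q \<in> rat_unit_squares"
    then have "(p * q) * inverse (q\<^sup>2) \<in> rat_unit_squares"
      using S.m_closed[OF _ sq(2)] by (simp add: rat_units_def)
    moreover have "(p * q) * inverse (q\<^sup>2) = p * inverse q"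
      using assms by (simp add: power2_eq_square field_simps)
    ultimately show "p * inverse q \<in> rat_unit_squares" by simp
  qed
  finally show ?thesis .
qed

lemma pell_alpha_hom:
  assumes "D \<noteq> 0"
  shows "group_hom (pell_conic D) rat_square_classes (pell_alpha D)"
proof -
  interpret C: comm_group "pell_conic D" by (rule pell_conic_comm_group)
  interpret S: normal rat_unit_squares rat_units by (rule rat_unit_squares_normal)
  have grp: "group rat_square_classes"
    unfolding rat_square_classes_def by (rule S.factorgroup_is_group)
  have carr: "of_int (alpha_rep D x) \<in> carrier rat_units" for x
    using alpha_rep_nonzero[OF assms] by (simp add: rat_units_def)
  have mult_rat: "p \<otimes>\<^bsub>rat_units\<^esub> q = p * q" for p q by (simp add: rat_units_def)
  have "pell_alpha D \<in> hom (pell_conic D) rat_square_classes"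
  proof (rule homI)
    fix P assume "P \<in> carrier (pell_conic D)"
    show "pell_alpha D P \<in> carrier rat_square_classes"
      using carr by (cases P) (auto simp: pell_alpha_eq rat_square_classes_def FactGroup_def RCOSETS_def)
  next
    fix P Q assume P: "P \<in> carrier (pell_conic D)" and Q: "Q \<in> carrier (pell_conic D)"
    obtain r s t u where PQ: "P = (r, s)" "Q = (t, u)" by (cases P, cases Q)
    obtain v w where vw: "P \<otimes>\<^bsub>pell_conic D\<^esub> Q = (v, w)" "2 * v = r * t + D * s * u"
      using P Q unfolding PQ by (rule pell_conic_mult_exact)
    obtain z where z: "alpha_rep D r * alpha_rep D t * alpha_rep D v = z\<^sup>2"
      using alpha_rep_mult_square[OF _ _ vw(2)] P Q by (auto simp: PQ pell_conic_def)
    have "z \<noteq> 0" using z alpha_rep_nonzero[OF assms] by auto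
    have "of_int (alpha_rep D v) * (of_int (alpha_rep D r) * of_int (alpha_rep D t)) = (of_int z :: rat)\<^sup>2"
      using arg_cong[OF z, of "of_int :: int \<Rightarrow> rat"] by (simp add: mult_ac)
    then have "of_int (alpha_rep D v) * (of_int (alpha_rep D r) * of_int (alpha_rep D t)) \<in> rat_unit_squares"
      using \<open>z \<noteq> 0\<close> by (auto simp: rat_unit_squares_def)
    then have "pell_alpha D (v, w) = rat_unit_squares #>\<^bsub>rat_units\<^esub>
        (of_int (alpha_rep D r) \<otimes>\<^bsub>rat_units\<^esub> of_int (alpha_rep D t))"
      using alpha_rep_nonzero[OF assms]
      by (simp add: pell_alpha_eq rat_square_coset_eq_iff mult_rat)
    also have "\<dots> = pell_alpha D P \<otimes>\<^bsub>rat_square_classes\<^esub> pell_alpha D Q"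
      using carr by (simp add: PQ pell_alpha_eq rat_square_classes_def S.rcos_sum)
    finally show "pell_alpha D (P \<otimes>\<^bsub>pell_conic D\<^esub> Q) =
        pell_alpha D P \<otimes>\<^bsub>rat_square_classes\<^esub> pell_alpha D Q"
      by (simp add: vw)
  qed
  then show ?thesis
    using grp by (simp add: group_hom_def group_hom_axioms_def C.group_axioms)
qed

text \<open>This moves the kernel condition from the rationals to the integers: an integer that is a
  rational square is the square of an integer.\<close>

lemma pell_alpha_one_iff:
  assumes "D \<noteq> 0"
  shows "pell_alpha D (x, y) = \<one>\<^bsub>rat_square_classes\<^esub> \<longleftrightarrow> (\<exists>m. alpha_rep D x = m\<^sup>2)"
proof -
  interpret comm_group rat_units by (rule rat_units_comm_group)
  interpret S: normal rat_unit_squares rat_units by (rule rat_unit_squares_normal)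
  have "\<one>\<^bsub>rat_square_classes\<^esub> = rat_unit_squares #>\<^bsub>rat_units\<^esub> 1"
    using coset_mult_one[OF S.subset] by (simp add: rat_square_classes_def) (simp add: rat_units_def)
  then have "pell_alpha D (x, y) = \<one>\<^bsub>rat_square_classes\<^esub>
      \<longleftrightarrow> of_int (alpha_rep D x) \<in> rat_unit_squares"
    using alpha_rep_nonzero[OF assms] by (simp add: pell_alpha_eq rat_square_coset_eq_iff)
  also have "\<dots> \<longleftrightarrow> (\<exists>m. alpha_rep D x = m\<^sup>2)"
  proof
    assume "of_int (alpha_rep D x) \<in> rat_unit_squares"
    then show "\<exists>m. alpha_rep D x = m\<^sup>2"
      unfolding rat_unit_squares_def by (blast elim: int_square_if_rat_square)
  next
    assume "\<exists>m. alpha_rep D x = m\<^sup>2"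
    then obtain m where m: "alpha_rep D x = m\<^sup>2" by blast
    then have "m \<noteq> 0" using alpha_rep_nonzero[OF assms, of x] by auto
    then show "of_int (alpha_rep D x) \<in> rat_unit_squares"
      using m unfolding rat_unit_squares_def by (auto intro!: exI[of _ "of_int m"])
  qed
  finally show ?thesis .
qed

section \<open>The kernel of \<alpha> and the doubles\<close>

lemma doubles_subset_kernel_pell_alpha:
  assumes "D \<noteq> 0"
  shows "doubles (pell_conic D) \<subseteq> kernel (pell_conic D) rat_square_classes (pell_alpha D)"
proof
  interpret C: comm_group "pell_conic D" by (rule pell_conic_comm_group)
  fix Q assume "Q \<in> doubles (pell_conic D)"
  then obtain P where P: "P \<in> carrier (pell_conic D)" and Q: "Q = P \<otimes>\<^bsub>pell_conic D\<^esub> P"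
    by (auto simp: doubles_def)
  obtain r s where rs: "P = (r, s)" by (cases P)
  obtain v w where vw: "Q = (v, w)" "2 * v = r * r + D * s * s"
    using P P unfolding Q rs by (rule pell_conic_mult_exact)
  obtain z where "alpha_rep D r * alpha_rep D r * alpha_rep D v = z\<^sup>2"
    using alpha_rep_mult_square[OF _ _ vw(2)] P by (auto simp: rs pell_conic_def)
  then have z: "(alpha_rep D r)\<^sup>2 * alpha_rep D v = z\<^sup>2" by (simp add: power2_eq_square)
  \<comment> \<open>Cancelling the nonzero square factor shows that \<open>alpha_rep D v\<close> is
    itself a square.\<close>
  then have "(alpha_rep D r)\<^sup>2 dvd z\<^sup>2" by (metis dvd_triv_left)
  then have "alpha_rep D r dvd z" by simp
  then obtain m where "z = alpha_rep D r * m" by blast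
  with z have "alpha_rep D v = m\<^sup>2"
    using alpha_rep_nonzero[OF assms, of r] by (simp add: power_mult_distrib)
  then have "pell_alpha D Q = \<one>\<^bsub>rat_square_classes\<^esub>"
    using vw(1) pell_alpha_one_iff[OF assms] by blast
  then show "Q \<in> kernel (pell_conic D) rat_square_classes (pell_alpha D)"
    using P by (simp add: kernel_def Q)
qed

lemma kernel_pell_alpha_subset_doubles:
  assumes "squarefree d" and D: "D = quad_disc d"
  shows "kernel (pell_conic D) rat_square_classes (pell_alpha D) \<subseteq> doubles (pell_conic D)"
proof
  have "D \<noteq> 0" using assms by (auto simp: quad_disc_def)
  fix Q assume "Q \<in> kernel (pell_conic D) rat_square_classes (pell_alpha D)"
  moreover obtain x y where Q: "Q = (x, y)" by (cases Q)
  ultimately have xy: "x\<^sup>2 - D * y\<^sup>2 = 4" and "pell_alpha D (x, y) = \<one>\<^bsub>rat_square_classes\<^esub>"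
    by (simp_all add: kernel_def pell_conic_def)
  then obtain m where m: "alpha_rep D x = m\<^sup>2" using pell_alpha_one_iff[OF \<open>D \<noteq> 0\<close>] by blast
  have "\<exists>P\<in>carrier (pell_conic D). Q = P \<otimes>\<^bsub>pell_conic D\<^esub> P"
  proof (cases "x = -2")
    case True
    with m have "- D = m\<^sup>2" by (simp add: alpha_rep_def)
    then have "D = -4" using minus_quad_disc_square[OF assms(1)] D by blast
    then show ?thesis
      \<comment> \<open>For D = -4 the point (0, 1) lies on the conic and its double is (-2, 0);
        \<open>xy\<close> forces \<open>y = 0\<close>.\<close>
      using True xy Q by (intro bexI[of _ "(0, 1)"]) (auto simp: pell_conic_def)
  next
    case False
    \<comment> \<open>Since 2(m, n) = (m^2 - 2, mn), the root \<open>m\<close> is the first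
      coordinate of the desired half of \<open>Q\<close>, and its second coordinate must be
      y/m.\<close>
    with m have x: "x = m\<^sup>2 - 2" and "m \<noteq> 0" by (auto simp: alpha_rep_def)
    have eq: "m\<^sup>2 * (m\<^sup>2 - 4) = D * y\<^sup>2"
      using xy by (simp add: x power2_eq_square algebra_simps)
    then have "m dvd y" using quad_disc_dvd[OF assms(1) \<open>m \<noteq> 0\<close>] D by simp
    then obtain n where n: "y = m * n" by blast
    have "m\<^sup>2 * (m\<^sup>2 - 4) = m\<^sup>2 * (D * n\<^sup>2)"
      using eq by (simp add: n power_mult_distrib mult_ac)
    then have mn: "m\<^sup>2 - D * n\<^sup>2 = 4" using \<open>m \<noteq> 0\<close> by simp
    \<comment> \<open>Written as an explicit multiple of 2, so that \<open>div 2\<close> in the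
      group law evaluates to \<open>x\<close>.\<close>
    then have "m * m + D * n * n = 2 * (m\<^sup>2 - 2)" by (simp add: power2_eq_square)
    then show ?thesis
      using mn by (intro bexI[of _ "(m, n)"]) (auto simp: pell_conic_def Q x n)
  qed
  then show "Q \<in> doubles (pell_conic D)" by (auto simp: doubles_def)
qed

section \<open>Assembling the exact sequence\<close>

text \<open>By commutativity, doubling is an endomorphism, and this is its image.\<close>

lemma (in comm_group) doubles_subgroup: "subgroup (doubles G) G"
proof (rule subgroupI)
  show "doubles G \<subseteq> carrier G" "doubles G \<noteq> {}" by (auto simp: doubles_def)
next
  fix a assume "a \<in> doubles G"
  then show "inv a \<in> doubles G" by (auto simp: doubles_def inv_mult intro: inv_closed)
next
  fix a b assume "a \<in> doubles G" "b \<in> doubles G"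
  then obtain p q where pq: "a = p \<otimes> p" "b = q \<otimes> q" "p \<in> carrier G" "q \<in> carrier G"
    by (auto simp: doubles_def)
  then have "a \<otimes> b = (p \<otimes> q) \<otimes> (p \<otimes> q)" by (simp add: m_ac)
  with pq show "a \<otimes> b \<in> doubles G" by (auto simp: doubles_def)
qed

text \<open>The zero on the left is the singleton group on the neutral element (2, 0), so both
  arrows before \<alpha> are inclusions given by \<open>id\<close>.\<close>

theorem theorem3p7:
  fixes d D :: int
  assumes "squarefree d" and "d \<noteq> 1" and "D = quad_disc d"
  shows "exact_at (singleton_group (2, 0)) id
           ((pell_conic D)\<lparr>carrier := doubles (pell_conic D)\<rparr>) id (pell_conic D)
       \<and> exact_at ((pell_conic D)\<lparr>carrier := doubles (pell_conic D)\<rparr>) id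
           (pell_conic D) (pell_alpha D) rat_square_classes
       \<and> kernel (pell_conic D) rat_square_classes (pell_alpha D) =
           {P \<otimes>\<^bsub>pell_conic D\<^esub> P | P. P \<in> carrier (pell_conic D)}"
proof -
  have "D \<noteq> 0" using assms by (auto simp: quad_disc_def)
  interpret C: comm_group "pell_conic D" by (rule pell_conic_comm_group)
  let ?E = "(pell_conic D)\<lparr>carrier := doubles (pell_conic D)\<rparr>"
  have sub: "subgroup (doubles (pell_conic D)) (pell_conic D)" by (rule C.doubles_subgroup)
  have E: "group ?E" using sub by (rule C.subgroup_imp_group)
  have one: "\<one>\<^bsub>pell_conic D\<^esub> = (2, 0)" by (simp add: pell_conic_def)
  have incl: "group_hom ?E (pell_conic D) id"
    using E sub
    by (auto simp: group_hom_def group_hom_axioms_def C.group_axioms hom_def dest: subgroup.mem_carrier)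
  have triv: "group_hom (singleton_group (2, 0)) ?E id"
    using E group.id_hom_singleton[OF E] by (simp add: group_hom_def group_hom_axioms_def one)
  \<comment> \<open>Exactness at the subgroup of doubles is injectivity of its inclusion.\<close>
  have ker_incl: "kernel ?E (pell_conic D) id = {(2, 0)}"
    using subgroup.one_closed[OF sub] by (auto simp: kernel_def one)
  have ker: "kernel (pell_conic D) rat_square_classes (pell_alpha D) = doubles (pell_conic D)"
    using kernel_pell_alpha_subset_doubles[OF assms(1,3)] doubles_subset_kernel_pell_alpha[OF \<open>D \<noteq> 0\<close>]
    by blast
  show ?thesis
    using incl triv ker_incl ker pell_alpha_hom[OF \<open>D \<noteq> 0\<close>]
    unfolding exact_at_def doubles_def[symmetric] by simp
qed

end
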